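(* Let $X$ be a set, $\Lambda$ a uniform Banach space, $\mathcal{B}$ a $\Lambda$-valued RKBS on $X$ and $K$ its reproducing kernel. Suppose that $f_n\in\mathcal{B}$, $n\in\mathbb{N}$, converges in $\mathcal{B}$ to some $f_0\in\mathcal{B}$. Then $f_n(x)$ converges to $f_0(x)$ in the topology of $\Lambda$ for each $x\in X$. Moreover, the convergence is uniform on any subset of $X$ on which $\|K(x,x)\|_{\mathcal{M}(\Lambda)}$ is bounded.
   Context: Banach spaces are over $\mathbb{C}$. A semi-inner product on a Banach space $V$ is a function $[\cdot,\cdot]_V:V\times V\to\mathbb{C}$ that is linear in its first variable, conjugate homogeneous in its second ($[f,\alpha g]_V=\overline{\alpha}[f,g]_V$), positive ($[f,f]_V>0$ for $f\neq0$), and satisfies $|[f,g]_V|\le[f,f]_V^{1/2}[g,g]_V^{1/2}$. It is compatible if $[f,f]_V^{1/2}=\|f\|_V$ for all $f\in V$. $V$ is uniformly convex if for all $\varepsilon>0$ there is $\delta>0$ with $\|f+g\|_V\le2-\delta$ whenever $\|f\|_V=\|g\|_V=1$ and $\|f-g\|_V\ge\varepsilon$. $V$ is uniformly Fréchet differentiable if $\lim_{t\in\mathbb{R},t\to0}(\|f+tg\|_V-\|f\|_V)/t$ exists uniformly over $f,g$ in the unit sphere of $V$. $V$ is called uniform if it is both uniformly convex and uniformly Fréchet differentiable. A uniform Banach space $V$ has a unique compatible semi-inner product (Giles), always denoted $[\cdot,\cdot]_V$. A Banach space of $\Lambda$-valued functions on $X$ is a Banach space $\mathcal{B}$ consisting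 of functions $X\to\Lambda$ such that $\|f\|_{\mathcal{B}}=0$ iff $f(x)=0$ for all $x\in X$. A $\Lambda$-valued RKBS on $X$ is a Banach space $\mathcal{B}$ of functions from $X$ to $\Lambda$, with both $\mathcal{B}$ and $\Lambda$ uniform, such that for every $x\in X$ the point evaluation $f\mapsto f(x)$ is continuous from $\mathcal{B}$ to $\Lambda$. $\mathcal{M}(\Lambda)$ is the set of all (not necessarily linear) maps $T:\Lambda\to\Lambda$ for which there is $\alpha\ge0$ with $\|Tu\|_\Lambda\le\alpha\|u\|_\Lambda$ for all $u$; $\|T\|_{\mathcal{M}(\Lambda)}$ is the infimum of such $\alpha$. The reproducing kernel of $\mathcal{B}$ is the unique function $K:X\times X\to\mathcal{M}(\Lambda)$ such that $K(x,\cdot)\xi\in\mathcal{B}$ and $[f(x),\xi]_\Lambda=[f,K(x,\cdot)\xi]_{\mathcal{B}}$ for all $f\in\mathcal{B}$, $x\in X$, $\xi\in\Lambda$, where $K(x,\cdot)\xi$ denotes the function $y\mapsto K(x,y)\xi$. *)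

theory Defs
  imports "HOL-Analysis.Analysis" "HOL-Library.Function_Algebras"
begin

class complex_vector = ab_group_add +
  fixes scaleC :: "complex \<Rightarrow> 'a \<Rightarrow> 'a" (infixr "*\<^sub>C" 75)
  assumes scaleC_add_right: "a *\<^sub>C (x + y) = a *\<^sub>C x + a *\<^sub>C y"
    and scaleC_add_left: "(a + b) *\<^sub>C x = a *\<^sub>C x + b *\<^sub>C x"
    and scaleC_scaleC: "a *\<^sub>C b *\<^sub>C x = (a * b) *\<^sub>C x"
    and scaleC_one: "1 *\<^sub>C x = x"

class complex_banach = complex_vector + banach +
  assumes scaleC_of_real: "complex_of_real r *\<^sub>C x = r *\<^sub>R x"
    and norm_scaleC: "norm (a *\<^sub>C x) = cmod a * norm x"

instantiation "fun" :: (type, complex_vector) complex_vector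
begin

definition scaleC_fun_def: "scaleC a f = (\<lambda>x. a *\<^sub>C f x)"

instance
  by standard
    (simp_all add: scaleC_fun_def plus_fun_def scaleC_add_right scaleC_add_left
      scaleC_scaleC scaleC_one)

end

interpretation complex_vector: module "scaleC :: complex \<Rightarrow> 'a \<Rightarrow> 'a::complex_vector"
  by standard (simp_all add: scaleC_add_right scaleC_add_left scaleC_scaleC scaleC_one)


section \<open>Uniform Banach spaces and their semi-inner product\<close>

text \<open>
  A Banach space is given by a carrier \<open>V\<close>, a linear subspace of an ambient complex vector
  space, and a norm \<open>N\<close>, of which only the values on \<open>V\<close> matter. A space of functions then has
  its own norm, while a space that is a type of class \<^class>\<open>complex_banach\<close> is the case of
  the carrier \<^term>\<open>UNIV\<close> and the norm \<^const>\<open>norm\<close>.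
\<close>

text \<open>
  The distance is set to 0 off \<open>V\<close> because \<^locale>\<open>Metric_space\<close> demands nonnegativity and
  symmetry also outside its carrier.
\<close>

definition norm_dist :: "'v::complex_vector set \<Rightarrow> ('v \<Rightarrow> real) \<Rightarrow> 'v \<Rightarrow> 'v \<Rightarrow> real" where
  "norm_dist V N f g = (if f \<in> V \<and> g \<in> V then N (f - g) else 0)"

definition complex_banach_on :: "'v::complex_vector set \<Rightarrow> ('v \<Rightarrow> real) \<Rightarrow> bool" where
  "complex_banach_on V N \<longleftrightarrow>
     module.subspace scaleC V \<and>
     (\<forall>f\<in>V. 0 \<le> N f) \<and>
     (\<forall>f\<in>V. N f = 0 \<longleftrightarrow> f = 0) \<and>
     (\<forall>f\<in>V. \<forall>a. N (a *\<^sub>C f) = cmod a * N f) \<and>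
     (\<forall>f\<in>V. \<forall>g\<in>V. N (f + g) \<le> N f + N g) \<and>
     Metric_space.mcomplete V (norm_dist V N)"

lemma complex_banach_on_UNIV: "complex_banach_on UNIV (norm :: 'l::complex_banach \<Rightarrow> real)"
proof -
  have d: "norm_dist (UNIV :: 'l set) norm = dist" by (simp add: norm_dist_def dist_norm fun_eq_iff)
  have "Metric_space.mcomplete UNIV (norm_dist (UNIV :: 'l set) norm)"
    unfolding d mcomplete_iff_complete by (rule complete_UNIV)
  then show ?thesis
    unfolding complex_banach_on_def complex_vector.subspace_def
    by (auto simp: norm_scaleC norm_triangle_ineq)
qed

lemma Metric_space_norm_dist:
  assumes "complex_banach_on V N"
  shows "Metric_space V (norm_dist V N)"
proof -
  have sub: "f - g \<in> V" if "f \<in> V" "g \<in> V" for f g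
    using assms that unfolding complex_banach_on_def by (auto intro: complex_vector.subspace_diff)
  note B = assms[unfolded complex_banach_on_def]
  have nonneg: "0 \<le> N f" and zero: "N f = 0 \<longleftrightarrow> f = 0"
      and scale: "N (a *\<^sub>C f) = cmod a * N f" if "f \<in> V" for f a
    using B that by simp_all
  have tri: "N (f + g) \<le> N f + N g" if "f \<in> V" "g \<in> V" for f g
    using B that by simp
  have comm: "N (f - g) = N (g - f)" if "f \<in> V" "g \<in> V" for f g
    using scale[OF sub[OF that], of "- 1"] by (simp add: scaleC_one)
  show ?thesis
  proof
    show "norm_dist V N f h \<le> norm_dist V N f g + norm_dist V N g h"
      if "f \<in> V" "g \<in> V" "h \<in> V" for f g h
      using tri[of "f - g" "g - h"] sub that unfolding norm_dist_def by simp
  qed (use nonneg zero comm sub in \<open>auto simp: norm_dist_def\<close>)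
qed

definition norm_topology :: "'v::complex_vector set \<Rightarrow> ('v \<Rightarrow> real) \<Rightarrow> 'v topology" where
  "norm_topology V N = Metric_space.mtopology V (norm_dist V N)"

definition uniformly_convex :: "'v::complex_vector set \<Rightarrow> ('v \<Rightarrow> real) \<Rightarrow> bool" where
  "uniformly_convex V N \<longleftrightarrow>
     (\<forall>\<epsilon>>0. \<exists>\<delta>>0. \<forall>f\<in>V. \<forall>g\<in>V.
        N f = 1 \<longrightarrow> N g = 1 \<longrightarrow> \<epsilon> \<le> N (f - g) \<longrightarrow> N (f + g) \<le> 2 - \<delta>)"

definition unit_sphere :: "'v::complex_vector set \<Rightarrow> ('v \<Rightarrow> real) \<Rightarrow> 'v set" where
  "unit_sphere V N = {f \<in> V. N f = 1}"

definition uniformly_Frechet_differentiable ::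
    "'v::complex_vector set \<Rightarrow> ('v \<Rightarrow> real) \<Rightarrow> bool" where
  "uniformly_Frechet_differentiable V N \<longleftrightarrow>
     (\<exists>D. uniform_limit (unit_sphere V N \<times> unit_sphere V N)
        (\<lambda>t (f, g). (N (f + complex_of_real t *\<^sub>C g) - N f) / t) D (at (0::real)))"

definition uniform_banach :: "'v::complex_vector set \<Rightarrow> ('v \<Rightarrow> real) \<Rightarrow> bool" where
  "uniform_banach V N \<longleftrightarrow>
     complex_banach_on V N \<and> uniformly_convex V N \<and> uniformly_Frechet_differentiable V N"

definition semi_inner_product_on ::
    "'v::complex_vector set \<Rightarrow> ('v \<Rightarrow> 'v \<Rightarrow> complex) \<Rightarrow> bool" where
  "semi_inner_product_on V s \<longleftrightarrow>
     (\<forall>f\<in>V. \<forall>g\<in>V. \<forall>h\<in>V. s (f + g) h = s f h + s g h) \<and>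
     (\<forall>f\<in>V. \<forall>g\<in>V. \<forall>a. s (a *\<^sub>C f) g = a * s f g) \<and>
     (\<forall>f\<in>V. \<forall>g\<in>V. \<forall>a. s f (a *\<^sub>C g) = cnj a * s f g) \<and>
     (\<forall>f\<in>V. f \<noteq> 0 \<longrightarrow> s f f \<in> \<real> \<and> 0 < Re (s f f)) \<and>
     (\<forall>f\<in>V. \<forall>g\<in>V. cmod (s f g) \<le> sqrt (Re (s f f)) * sqrt (Re (s g g)))"

definition compatible_semi_inner_product ::
    "'v::complex_vector set \<Rightarrow> ('v \<Rightarrow> real) \<Rightarrow> ('v \<Rightarrow> 'v \<Rightarrow> complex) \<Rightarrow> bool" where
  "compatible_semi_inner_product V N s \<longleftrightarrow>
     semi_inner_product_on V s \<and> (\<forall>f\<in>V. sqrt (Re (s f f)) = N f)"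

text \<open>
  The compatible semi-inner product of a uniform Banach space is unique as a function on
  \<open>V \<times> V\<close> only, its values elsewhere being arbitrary; hence \<open>SOME\<close> instead of \<open>THE\<close>.
\<close>

definition semi_inner ::
    "'v::complex_vector set \<Rightarrow> ('v \<Rightarrow> real) \<Rightarrow> 'v \<Rightarrow> 'v \<Rightarrow> complex" where
  "semi_inner V N = (SOME s. compatible_semi_inner_product V N s)"

text \<open>
  Giles: existence and uniqueness of the compatible semi-inner product. With \<open>p g f\<close> the
  derivative of the norm at \<open>g\<close> in direction \<open>f\<close>, it is
  \<open>N g * (p g f - \<i> * p g (\<i> *\<^sub>C f))\<close>.
\<close>

context
  fixes V :: "'v::complex_vector set" and N :: "'v \<Rightarrow> real"
  assumes ban: "complex_banach_on V N" and frechet: "uniformly_Frechet_differentiable V N"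
begin

private abbreviation q where
  "q g f \<equiv> (\<lambda>t. (N (g + complex_of_real t *\<^sub>C f) - N g) / t)"
private definition p where "p g f = Lim (at (0::real)) (q g f)"
private definition s where
  "s f g = (if g = 0 then 0 else
     complex_of_real (N g) * (complex_of_real (p g f) - \<i> * complex_of_real (p g (\<i> *\<^sub>C f))))"

private lemma sub: "0 \<in> V" "f \<in> V \<Longrightarrow> g \<in> V \<Longrightarrow> f + g \<in> V" "f \<in> V \<Longrightarrow> a *\<^sub>C f \<in> V"
  using ban unfolding complex_banach_on_def complex_vector.subspace_def by auto
private lemma N: "f \<in> V \<Longrightarrow> 0 \<le> N f" "f \<in> V \<Longrightarrow> N f = 0 \<longleftrightarrow> f = 0"
    "f \<in> V \<Longrightarrow> N (a *\<^sub>C f) = cmod a * N f" "f \<in> V \<Longrightarrow> g \<in> V \<Longrightarrow> N (f + g) \<le> N f + N g"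
  using ban unfolding complex_banach_on_def by simp_all
private lemma Npos: "f \<in> V \<Longrightarrow> f \<noteq> 0 \<Longrightarrow> 0 < N f"
  using N(1,2) by (metis less_eq_real_def)

private lemma q_scale:
  assumes "g \<in> V" "f \<in> V" "0 < a" "0 < b" "t \<noteq> 0"
  shows "q (complex_of_real a *\<^sub>C g) (complex_of_real b *\<^sub>C f) t = b * q g f (t * b / a)"
proof -
  have e: "complex_of_real a *\<^sub>C g + complex_of_real t *\<^sub>C complex_of_real b *\<^sub>C f
     = complex_of_real a *\<^sub>C (g + complex_of_real (t * b / a) *\<^sub>C f)"
    using assms by (simp add: scaleC_add_right scaleC_scaleC)
  have "N (complex_of_real a *\<^sub>C (g + complex_of_real (t * b / a) *\<^sub>C f))
      = a * N (g + complex_of_real (t * b / a) *\<^sub>C f)"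
    using N(3)[of "g + complex_of_real (t * b / a) *\<^sub>C f" "complex_of_real a"] assms sub by simp
  moreover have "N (complex_of_real a *\<^sub>C g) = a * N g"
    using N(3)[of g "complex_of_real a"] assms by simp
  ultimately show ?thesis unfolding e using assms by (simp add: divide_simps) (simp add: algebra_simps)
qed

private lemma lin_at_0: "r \<noteq> 0 \<Longrightarrow> filterlim (\<lambda>t::real. t * r) (at 0) (at 0)"
  by (rule filterlim_atI) (auto intro!: tendsto_eq_intros simp: eventually_at_filter)

private lemma tendsto_unit:
  assumes "g \<in> unit_sphere V N" "f \<in> unit_sphere V N"
  shows "\<exists>d. (q g f \<longlongrightarrow> d) (at 0)"
proof -
  obtain D where D: "uniform_limit (unit_sphere V N \<times> unit_sphere V N)
        (\<lambda>t (f, g). (N (f + complex_of_real t *\<^sub>C g) - N f) / t) D (at (0::real))"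
    using frechet unfolding uniformly_Frechet_differentiable_def by blast
  from tendsto_uniform_limitI[OF D, of "(g,f)"] assms show ?thesis by auto
qed

private lemma tendsto_ex:
  assumes "g \<in> V" "f \<in> V" "g \<noteq> 0"
  shows "\<exists>d. (q g f \<longlongrightarrow> d) (at 0)"
proof (cases "f = 0")
  case True
  then show ?thesis by (intro exI[of _ 0]) simp
next
  case False
  define g' f' where "g' = complex_of_real (1 / N g) *\<^sub>C g" and "f' = complex_of_real (1 / N f) *\<^sub>C f"
  have P: "0 < N g" "0 < N f" using Npos assms False by auto
  have u: "g' \<in> unit_sphere V N" "f' \<in> unit_sphere V N"
    unfolding unit_sphere_def g'_def f'_def using P N(3)[of g "complex_of_real (1 / N g)"]
      N(3)[of f "complex_of_real (1 / N f)"] assms sub by (auto simp: norm_divide)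
  obtain d where d: "(q g' f' \<longlongrightarrow> d) (at 0)" using tendsto_unit[OF u] by blast
  have gg: "g = complex_of_real (N g) *\<^sub>C g'" "f = complex_of_real (N f) *\<^sub>C f'"
    unfolding g'_def f'_def using P by (auto simp: scaleC_scaleC scaleC_one)
  have "((\<lambda>t. N f * q g' f' (t * (N f / N g))) \<longlongrightarrow> N f * d) (at 0)"
    using P by (intro tendsto_mult tendsto_const filterlim_compose[OF d] lin_at_0) auto
  moreover have "eventually (\<lambda>t. N f * q g' f' (t * (N f / N g)) = q g f t) (at 0)"
    unfolding eventually_at_filter
  proof (intro always_eventually allI impI)
    fix t :: real assume "t \<noteq> 0"
    then show "N f * q g' f' (t * (N f / N g)) = q g f t"
      using q_scale[of g' f' "N g" "N f" t] u P unfolding gg(1)[symmetric] gg(2)[symmetric] unit_sphere_def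
      by simp
  qed
  ultimately show ?thesis by (blast intro: Lim_transform_eventually)
qed

private lemma p_lim: "g \<in> V \<Longrightarrow> f \<in> V \<Longrightarrow> g \<noteq> 0 \<Longrightarrow> (q g f \<longlongrightarrow> p g f) (at 0)"
  unfolding p_def using tendsto_ex[of g f] tendsto_Lim[OF trivial_limit_at, of "q g f"] by auto

private lemma p_eqI: "g \<in> V \<Longrightarrow> f \<in> V \<Longrightarrow> g \<noteq> 0 \<Longrightarrow> (q g f \<longlongrightarrow> d) (at 0) \<Longrightarrow> p g f = d"
  using p_lim[of g f] tendsto_unique[OF trivial_limit_at, of "q g f"] by auto

private lemma p_real:
  assumes "g \<in> V" "f \<in> V" "g \<noteq> 0"
  shows "p g (complex_of_real r *\<^sub>C f) = r * p g f"
proof (cases "r = 0")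
  case True
  then show ?thesis using assms sub by (intro p_eqI) (auto simp: )
next
  case False
  have "((\<lambda>t. r * q g f (t * r)) \<longlongrightarrow> r * p g f) (at 0)"
    using False assms by (intro tendsto_mult tendsto_const filterlim_compose[OF p_lim] lin_at_0) auto
  moreover have "(\<lambda>t. r * q g f (t * r)) = q g (complex_of_real r *\<^sub>C f)"
    using False by (auto simp: scaleC_scaleC)
  ultimately show ?thesis using assms sub by (intro p_eqI) auto
qed

private lemma p_subadd:
  assumes "g \<in> V" "f \<in> V" "h \<in> V" "g \<noteq> 0"
  shows "p g (f + h) \<le> p g f + p g h"
proof -
  have l: "((\<lambda>t. q g f (t * 2) + q g h (t * 2)) \<longlongrightarrow> p g f + p g h) (at_right 0)"
    using assms by (intro tendsto_mono[OF at_le[OF subset_UNIV] tendsto_add]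
        filterlim_compose[OF p_lim] lin_at_0) auto
  have r: "(q g (f + h) \<longlongrightarrow> p g (f + h)) (at_right 0)"
    using assms sub by (intro tendsto_mono[OF at_le[OF subset_UNIV] p_lim]) auto
  show ?thesis
  proof (rule tendsto_le[OF _ l r])
    show "eventually (\<lambda>t. q g (f + h) t \<le> q g f (t * 2) + q g h (t * 2)) (at_right 0)"
      unfolding eventually_at_filter
    proof (intro always_eventually allI impI)
      fix t :: real assume "t \<noteq> 0" "t \<in> {0<..}"
      then have t: "0 < t" by auto
      let ?a = "g + complex_of_real (t * 2) *\<^sub>C f" and ?b = "g + complex_of_real (t * 2) *\<^sub>C h"
      have V: "?a \<in> V" "?b \<in> V" using assms sub by auto
      have dbl: "complex_of_real 2 *\<^sub>C x = x + x" for x :: 'v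
        using scaleC_add_left[of 1 1 x] by (simp add: scaleC_one)
      have dbl2: "complex_of_real (t * 2) *\<^sub>C x = complex_of_real t *\<^sub>C x + complex_of_real t *\<^sub>C x" for x :: 'v
        by (simp only: mult_2_right of_real_add scaleC_add_left)
      have "complex_of_real 2 *\<^sub>C (g + complex_of_real t *\<^sub>C (f + h)) = ?a + ?b"
        unfolding scaleC_add_right dbl2 unfolding dbl by (simp add: ac_simps)
      then have "2 * N (g + complex_of_real t *\<^sub>C (f + h)) \<le> N ?a + N ?b"
        using N(3)[of "g + complex_of_real t *\<^sub>C (f + h)" "complex_of_real 2"] N(4)[OF V] assms sub by simp
      then show "q g (f + h) t \<le> q g f (t * 2) + q g h (t * 2)"
        using t by (simp add: divide_simps)
    qed
  qed simp
qed

private lemma neg: "complex_of_real (- 1) *\<^sub>C f = - f" for f :: 'v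
  by (simp add: scaleC_one)

private lemma p_add:
  assumes "g \<in> V" "f \<in> V" "h \<in> V" "g \<noteq> 0"
  shows "p g (f + h) = p g f + p g h"
proof -
  have m: "p g (- x) = - p g x" "- x \<in> V" if "x \<in> V" for x
    using p_real[of g x "-1"] assms that sub(3)[of x "complex_of_real (-1)"] unfolding neg by auto
  have "p g (- f + - h) \<le> p g (- f) + p g (- h)"
    using assms m by (intro p_subadd) auto
  moreover have "p g (- (f + h)) = - p g (f + h)" using m assms sub by blast
  ultimately have "p g f + p g h \<le> p g (f + h)" using m assms by simp
  with p_subadd[OF assms] show ?thesis by simp
qed

private lemma p_le:
  assumes "g \<in> V" "f \<in> V" "g \<noteq> 0"
  shows "p g f \<le> N f"
proof -
  have r: "(q g f \<longlongrightarrow> p g f) (at_right 0)"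
    using assms sub by (intro tendsto_mono[OF at_le[OF subset_UNIV] p_lim]) auto
  show ?thesis
  proof (rule tendsto_upperbound[OF r])
    show "eventually (\<lambda>t. q g f t \<le> N f) (at_right 0)"
      unfolding eventually_at_filter
    proof (intro always_eventually allI impI)
      fix t :: real assume "t \<noteq> 0" "t \<in> {0<..}"
      then show "q g f t \<le> N f"
        using N(4)[of g "complex_of_real t *\<^sub>C f"] N(3)[of f "complex_of_real t"] assms sub
        by (simp add: divide_simps mult.commute)
    qed
  qed simp
qed

private lemma p_self:
  assumes "g \<in> V" "g \<noteq> 0"
  shows "p g g = N g"
proof (rule p_eqI)
  have "eventually (\<lambda>t::real. \<bar>t\<bar> < 1) (at 0)"
    unfolding eventually_at by (intro exI[of _ 1]) auto
  then have "eventually (\<lambda>t. N g = q g g t) (at 0)"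
    using eventually_neq_at_within[of 0 0 UNIV]
  proof eventually_elim
    case (elim t)
    have "g + complex_of_real t *\<^sub>C g = complex_of_real (1 + t) *\<^sub>C g"
      by (simp add: scaleC_add_left scaleC_one)
    then have "N (g + complex_of_real t *\<^sub>C g) = (1 + t) * N g"
      using N(3)[of g "complex_of_real (1 + t)"] assms elim
      by (simp del: of_real_add add: norm_of_real)
    with elim show ?case by (simp add: divide_simps algebra_simps)
  qed
  then show "(q g g \<longlongrightarrow> N g) (at 0)" 
    by (intro tendsto_eventually) (simp add: eq_commute)
qed (use assms in auto)

private lemma p_scale:
  assumes "g \<in> V" "f \<in> V" "g \<noteq> 0" "c \<noteq> 0"
  shows "p (c *\<^sub>C g) f = p g ((cnj c / cmod c) *\<^sub>C f)"
proof -
  let ?r = "cmod c" let ?h = "(cnj c / cmod c) *\<^sub>C f"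
  have r: "0 < ?r" using assms by simp
  have inv: "c * cnj c = complex_of_real (?r * ?r)" 
    by (simp add: complex_norm_square[symmetric] power2_eq_square)
  have f: "f = (c / ?r) *\<^sub>C ?h"
  proof -
    have "(c / ?r) * (cnj c / ?r) = 1"
      unfolding times_divide_times_eq inv of_real_mult using r by simp
    then show ?thesis by (simp only: scaleC_scaleC scaleC_one)
  qed
  have V: "?h \<in> V" using assms sub by auto
  have z: "c *\<^sub>C g \<noteq> 0" using assms N(2)[OF sub(3)[OF assms(1)], of c] N(2)[OF assms(1)] N(3)[OF assms(1), of c] by simp
  have "((\<lambda>t. q g ?h (t * (1 / ?r))) \<longlongrightarrow> p g ?h) (at 0)"
    using r assms V by (intro filterlim_compose[OF p_lim] lin_at_0) auto
  moreover have "eventually (\<lambda>t. q g ?h (t * (1 / ?r)) = q (c *\<^sub>C g) f t) (at 0)"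
    unfolding eventually_at_filter
  proof (intro always_eventually allI impI)
    fix t :: real assume "t \<noteq> 0"
    have frac: "(x - y) / (t * (1 / ?r)) = (?r * x - ?r * y) / t" for x y :: real
      using r \<open>t \<noteq> 0\<close> by (simp add: field_simps)
    have e: "c *\<^sub>C g + complex_of_real t *\<^sub>C f = c *\<^sub>C (g + complex_of_real (t * (1 / ?r)) *\<^sub>C ?h)"
      by (subst f) (simp add: scaleC_add_right scaleC_scaleC mult.commute mult.left_commute)
    show "q g ?h (t * (1 / ?r)) = q (c *\<^sub>C g) f t"
      unfolding e N(3)[OF assms(1)] N(3)[OF sub(2)[OF assms(1) sub(3)[OF V]]]
      by (rule frac)
  qed
  ultimately have "(q (c *\<^sub>C g) f \<longlongrightarrow> p g ?h) (at 0)" by (rule Lim_transform_eventually)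
  then show ?thesis using assms sub z by (intro p_eqI) auto
qed

private lemma s_add: "f \<in> V \<Longrightarrow> g \<in> V \<Longrightarrow> h \<in> V \<Longrightarrow> s (f + g) h = s f h + s g h"
  unfolding s_def using p_add sub by (simp add: scaleC_add_right algebra_simps)

private lemma s_i: "f \<in> V \<Longrightarrow> g \<in> V \<Longrightarrow> s (\<i> *\<^sub>C f) g = \<i> * s f g"
  using p_real[of g f "-1"] unfolding s_def by (simp add: scaleC_scaleC algebra_simps)

private lemma s_real: "f \<in> V \<Longrightarrow> g \<in> V \<Longrightarrow> s (complex_of_real r *\<^sub>C f) g = r * s f g"
  using p_real[of g f r] p_real[of g "\<i> *\<^sub>C f" r] sub
  unfolding s_def by (simp add: scaleC_scaleC algebra_simps)

private lemma s_scale: 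
  assumes "f \<in> V" "g \<in> V" shows "s (a *\<^sub>C f) g = a * s f g"
proof -
  have a: "a = complex_of_real (Re a) + \<i> * complex_of_real (Im a)" by (rule complex_eq)
  have "a *\<^sub>C f = complex_of_real (Re a) *\<^sub>C f + \<i> *\<^sub>C complex_of_real (Im a) *\<^sub>C f"
    by (subst a) (simp add: scaleC_add_left scaleC_scaleC)
  then have "s (a *\<^sub>C f) g = (complex_of_real (Re a) + \<i> * complex_of_real (Im a)) * s f g"
    using s_add[of "complex_of_real (Re a) *\<^sub>C f" "\<i> *\<^sub>C complex_of_real (Im a) *\<^sub>C f" g]
      s_i[of "complex_of_real (Im a) *\<^sub>C f" g] s_real[of f g] assms sub
    by (simp only: distrib_right mult.assoc)
  then show ?thesis using a by simp
qed

private lemma s_conj: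
  assumes "f \<in> V" "g \<in> V" shows "s f (a *\<^sub>C g) = cnj a * s f g"
proof (cases "a = 0 \<or> g = 0")
  case True then show ?thesis unfolding s_def by auto
next
  case False
  then have z: "a *\<^sub>C g \<noteq> 0" using assms N(2,3) sub by (metis mult_eq_0_iff norm_eq_zero)
  let ?c = "cnj a / cmod a"
  have "s f (a *\<^sub>C g) = cmod a * s (?c *\<^sub>C f) g"
    unfolding s_def using z False assms sub N(3)[of g a] p_scale[of g f a] p_scale[of g "\<i> *\<^sub>C f" a]
    by (simp add: scaleC_scaleC mult.commute)
  then show ?thesis using assms False by (simp add: s_scale)
qed

private lemma Re_s: "f \<in> V \<Longrightarrow> g \<in> V \<Longrightarrow> Re (s f g) \<le> N f * N g"
  unfolding s_def using mult_left_mono[OF p_le[of g f] N(1)[of g]] N(1)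
  by (auto simp: mult.commute)

private lemma s_bound:
  assumes "f \<in> V" "g \<in> V" shows "cmod (s f g) \<le> N f * N g"
proof (cases "s f g = 0")
  case True then show ?thesis using N(1) assms by simp
next
  case False
  let ?c = "cnj (s f g) / cmod (s f g)"
  have "s (?c *\<^sub>C f) g = cmod (s f g)"
    using assms False s_scale[of f g ?c] 
    by (simp add: field_simps complex_norm_square[symmetric] power2_eq_square)
  then have "cmod (s f g) \<le> N (?c *\<^sub>C f) * N g"
    using Re_s[of "?c *\<^sub>C f" g] assms sub by simp
  then show ?thesis using N(3)[of f ?c] assms False by (simp add: norm_divide)
qed

private lemma s_self:
  assumes "f \<in> V" shows "s f f = complex_of_real (N f ^ 2)"
proof (cases "f = 0")
  case True then show ?thesis using N(2) assms unfolding s_def by auto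
next
  case False
  have R: "Re (s f f) = N f ^ 2" using False p_self assms unfolding s_def by (simp add: power2_eq_square)
  have "cmod (s f f) \<le> N f ^ 2" using s_bound[of f f] assms by (simp add: power2_eq_square)
  then have "Re (s f f) ^ 2 + Im (s f f) ^ 2 \<le> (N f ^ 2)^2"
    by (metis cmod_power2 norm_ge_zero power_mono)
  then have "Im (s f f) = 0" using R by simp
  with R show ?thesis by (simp add: complex_eq_iff)
qed

lemma ex_compatible_semi_inner_product: "\<exists>s. compatible_semi_inner_product V N s"
proof (intro exI[of _ s])
  have [simp]: "sqrt (Re (s f f)) = N f" if "f \<in> V" for f
    using s_self N(1) that by simp
  show "compatible_semi_inner_product V N s"
    unfolding compatible_semi_inner_product_def semi_inner_product_on_def
    using s_add s_scale s_conj s_bound N(1,2)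
    by (auto simp: s_self abs_of_nonneg simp del: of_real_power)
qed

lemma compatible_semi_inner_product_unique:
  assumes c: "compatible_semi_inner_product V N s1" "compatible_semi_inner_product V N s2"
    and fg: "f \<in> V" "g \<in> V"
  shows "s1 f g = s2 f g"
proof -
  have eq: "s' f g = s f g" if "compatible_semi_inner_product V N s'" for s'
  proof -
    have s': "s' (x + y) z = s' x z + s' y z" "s' (a *\<^sub>C x) y = a * s' x y"
        "s' x (a *\<^sub>C y) = cnj a * s' x y" "cmod (s' x y) \<le> N x * N y" 
        "sqrt (Re (s' x x)) = N x" if "x \<in> V" "y \<in> V" "z \<in> V" for x y z a
      using that \<open>compatible_semi_inner_product V N s'\<close>
      unfolding compatible_semi_inner_product_def semi_inner_product_on_def by auto
    show ?thesis
    proof (cases "g = 0")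
      case True
      then show ?thesis using s'(3)[of f 0 0 0] fg sub unfolding s_def by simp
    next
      case g: False
      have le: "Re (s' x g) \<le> N g * p g x" if x: "x \<in> V" for x
      proof -
        have r: "((\<lambda>t. N g * q g x t) \<longlongrightarrow> N g * p g x) (at_right 0)"
          by (intro tendsto_mult tendsto_const tendsto_mono[OF at_le[OF subset_UNIV] p_lim] fg g x)
        show ?thesis
        proof (rule tendsto_lowerbound[OF r])
          show "eventually (\<lambda>t. Re (s' x g) \<le> N g * q g x t) (at_right 0)"
            unfolding eventually_at_filter
          proof (intro always_eventually allI impI)
            fix t :: real assume "t \<noteq> 0" "t \<in> {0<..}"
            then have t: "0 < t" by auto
            have tx: "complex_of_real t *\<^sub>C x \<in> V" using sub(3) x by blast
            have "Re (s' g g) = N g ^ 2"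
              using s'(5)[of g g g] fg Npos[of g] g
              by (metis less_eq_real_def real_sqrt_gt_0_iff real_sqrt_pow2)
            moreover have "Re (s' (g + complex_of_real t *\<^sub>C x) g) \<le> N (g + complex_of_real t *\<^sub>C x) * N g"
              using s'(4)[of "g + complex_of_real t *\<^sub>C x" g] complex_Re_le_cmod order_trans fg tx sub(2)
              by blast
            moreover have "s' (g + complex_of_real t *\<^sub>C x) g = s' g g + complex_of_real t * s' x g"
              using s'(1)[of g "complex_of_real t *\<^sub>C x" g] s'(2)[of x g x "complex_of_real t"] fg x tx by simp
            ultimately have "N g ^ 2 + t * Re (s' x g) \<le> N (g + complex_of_real t *\<^sub>C x) * N g" by simp
            then have "Re (s' x g) * t \<le> N g * (N (g + complex_of_real t *\<^sub>C x) - N g)"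
              by (simp add: power2_eq_square algebra_simps)
            then show "Re (s' x g) \<le> N g * q g x t" using t by (simp add: pos_le_divide_eq)
          qed
        qed simp
      qed
      have Re_eq: "Re (s' x g) = N g * p g x" if x: "x \<in> V" for x
      proof -
        have "complex_of_real (- 1) *\<^sub>C x \<in> V" using sub(3) x by blast
        from le[OF this] have "N g * p g x \<le> Re (s' x g)"
          using p_real[of g x "-1"] s'(2)[of x g x "complex_of_real (-1)"] x fg g by simp
        with le[OF x] show ?thesis by simp
      qed
      have "Im (s' f g) = - Re (s' (\<i> *\<^sub>C f) g)" using s'(2)[of f g f \<i>] fg by simp
      then show ?thesis
        using Re_eq[OF fg(1)] Re_eq[OF sub(3)[OF fg(1)], of \<i>] g
        unfolding s_def by (simp add: complex_eq_iff)
    qed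
  qed
  show ?thesis using eq[OF c(1)] eq[OF c(2)] by simp
qed

end


section \<open>Vector-valued reproducing kernel Banach spaces\<close>

text \<open>
  A function on the set \<open>X\<close> is represented by its extension by zero to the whole type, so that
  the pointwise operations are those of the function type.
\<close>

definition banach_function_space ::
    "'x set \<Rightarrow> ('x \<Rightarrow> 'l::complex_banach) set \<Rightarrow> (('x \<Rightarrow> 'l) \<Rightarrow> real) \<Rightarrow> bool" where
  "banach_function_space X B N \<longleftrightarrow>
     complex_banach_on B N \<and>
     (\<forall>f\<in>B. \<forall>x. x \<notin> X \<longrightarrow> f x = 0) \<and>
     (\<forall>f\<in>B. N f = 0 \<longleftrightarrow> (\<forall>x\<in>X. f x = 0))"

definition RKBS ::
    "'x set \<Rightarrow> ('x \<Rightarrow> 'l::complex_banach) set \<Rightarrow> (('x \<Rightarrow> 'l) \<Rightarrow> real) \<Rightarrow> bool" where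
  "RKBS X B N \<longleftrightarrow>
     banach_function_space X B N \<and>
     uniform_banach B N \<and>
     uniform_banach (UNIV :: 'l set) norm \<and>
     (\<forall>x\<in>X. continuous_map (norm_topology B N) euclidean (\<lambda>f. f x))"

definition bounded_maps :: "('l::complex_banach \<Rightarrow> 'l) set" where
  "bounded_maps = {T. \<exists>\<alpha>\<ge>0. \<forall>u. norm (T u) \<le> \<alpha> * norm u}"

definition bounded_maps_norm :: "('l::complex_banach \<Rightarrow> 'l) \<Rightarrow> real" where
  "bounded_maps_norm T = Inf {\<alpha>. 0 \<le> \<alpha> \<and> (\<forall>u. norm (T u) \<le> \<alpha> * norm u)}"

definition kernel_section ::
    "'x set \<Rightarrow> ('x \<Rightarrow> 'x \<Rightarrow> 'l \<Rightarrow> 'l::complex_banach) \<Rightarrow> 'x \<Rightarrow> 'l \<Rightarrow> 'x \<Rightarrow> 'l" where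
  "kernel_section X K x \<xi> = (\<lambda>y. if y \<in> X then K x y \<xi> else 0)"

definition reproducing_kernel ::
    "'x set \<Rightarrow> ('x \<Rightarrow> 'l::complex_banach) set \<Rightarrow> (('x \<Rightarrow> 'l) \<Rightarrow> real) \<Rightarrow>
     ('x \<Rightarrow> 'x \<Rightarrow> 'l \<Rightarrow> 'l) \<Rightarrow> bool" where
  "reproducing_kernel X B N K \<longleftrightarrow>
     (\<forall>x\<in>X. \<forall>y\<in>X. K x y \<in> bounded_maps) \<and>
     (\<forall>x\<in>X. \<forall>\<xi>. kernel_section X K x \<xi> \<in> B) \<and>
     (\<forall>f\<in>B. \<forall>x\<in>X. \<forall>\<xi>.
        semi_inner UNIV norm (f x) \<xi> = semi_inner B N f (kernel_section X K x \<xi>))"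

end

(* Testing the reproducing property of g at x against the vector g x itself gives
   norm (g x) ^ 2 \<le> N g * N (kernel_section X K x (g x)), and the second factor is
   controlled by applying the reproducing property once more, to the kernel section. The result is
   norm (g x) \<le> N g * sqrt (norm of K x x), which is applied to the differences f n - f0. *)

theory Submission
  imports Defs
begin

text \<open>The infimum is itself an admissible constant: for \<open>u \<noteq> 0\<close> the
  quotient \<open>norm (T u) / norm u\<close> lies below every admissible constant, hence below
  their infimum.\<close>

lemma bounded_maps_normD:
  assumes "T \<in> bounded_maps"
  shows "norm (T u) \<le> bounded_maps_norm T * norm u"
proof (cases "u = 0")
  case True
  \<comment> \<open>\<open>T\<close> need not be linear, so \<open>T 0 = 0\<close> has to come from
    an admissible constant.\<close>
  obtain \<alpha> where "norm (T 0) \<le> \<alpha> * norm (0 :: 'a)"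
    using assms unfolding bounded_maps_def by blast
  with True show ?thesis by simp
next
  case False
  have "norm (T u) / norm u \<le> bounded_maps_norm T"
    unfolding bounded_maps_norm_def
    by (rule cInf_greatest) (use assms False in \<open>auto simp: bounded_maps_def pos_divide_le_eq\<close>)
  with False show ?thesis by (simp add: pos_divide_le_eq)
qed

lemma bounded_maps_norm_nonneg:
  assumes "T \<in> bounded_maps"
  shows "0 \<le> bounded_maps_norm T"
  unfolding bounded_maps_norm_def
  by (rule cInf_greatest) (use assms in \<open>auto simp: bounded_maps_def\<close>)

text \<open>Giles' existence result turns the \<open>SOME\<close> choice into an actual compatible
  semi-inner product.\<close>

lemma compatible_semi_inner_product_semi_inner:
  assumes "uniform_banach V N"
  shows "compatible_semi_inner_product V N (semi_inner V N)"
proof -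
  have "\<exists>s. compatible_semi_inner_product V N s"
    using assms by (intro ex_compatible_semi_inner_product) (auto simp: uniform_banach_def)
  then show ?thesis
    unfolding semi_inner_def by (rule someI_ex)
qed

lemma semi_inner_bound:
  assumes "uniform_banach V N" "f \<in> V" "g \<in> V"
  shows "cmod (semi_inner V N f g) \<le> N f * N g"
proof -
  have "semi_inner_product_on V (semi_inner V N)"
    and N: "sqrt (Re (semi_inner V N h h)) = N h" if "h \<in> V" for h
    using compatible_semi_inner_product_semi_inner[OF assms(1)] that
    by (simp_all add: compatible_semi_inner_product_def)
  then have "cmod (semi_inner V N f g)
      \<le> sqrt (Re (semi_inner V N f f)) * sqrt (Re (semi_inner V N g g))"
    using assms(2,3) by (simp add: semi_inner_product_on_def)
  then show ?thesis
    by (simp only: N assms(2,3))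
qed

text \<open>Stated with \<open>cmod\<close>, so that it chains directly with
  \<open>semi_inner_bound\<close>.\<close>

lemma norm_square_le_semi_inner_self:
  assumes "uniform_banach V N" "f \<in> V"
  shows "(N f)\<^sup>2 \<le> cmod (semi_inner V N f f)"
proof -
  have s: "sqrt (Re (semi_inner V N f f)) = N f"
    using compatible_semi_inner_product_semi_inner[OF assms(1)] assms(2)
    by (simp add: compatible_semi_inner_product_def)
  have "0 \<le> N f"
    using assms by (simp add: uniform_banach_def complex_banach_on_def)
  \<comment> \<open>\<open>sqrt\<close> is odd on the reals, so a nonnegative root forces a
    nonnegative argument. This also covers \<open>f = 0\<close>, about which the positivity axiom is
    silent.\<close>
  then have "0 \<le> Re (semi_inner V N f f)"
    unfolding s[symmetric] by simp
  then have "(N f)\<^sup>2 = Re (semi_inner V N f f)"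
    unfolding s[symmetric] by (rule real_sqrt_pow2)
  then show ?thesis by (simp add: complex_Re_le_cmod)
qed

text \<open>The reproducing property with the section \<open>k\<close> itself as the function turns
  \<open>[k, k]\<close> in \<open>B\<close> into \<open>[K x x \<xi>, \<xi>]\<close> in the value
  space, where Cauchy-Schwarz and the bound on \<open>K x x\<close> apply.\<close>

lemma kernel_section_norm_le:
  assumes "RKBS X B N" "reproducing_kernel X B N K" "x \<in> X"
  shows "N (kernel_section X K x \<xi>) \<le> sqrt (bounded_maps_norm (K x x)) * norm \<xi>"
proof -
  let ?k = "kernel_section X K x \<xi>"
  have U: "uniform_banach B N" "uniform_banach (UNIV :: 'b set) norm"
    using assms(1) by (auto simp: RKBS_def)
  have k: "?k \<in> B" and K: "K x x \<in> bounded_maps"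
    and rep: "semi_inner UNIV norm (?k x) \<xi> = semi_inner B N ?k ?k"
    using assms(2,3) unfolding reproducing_kernel_def by blast+
  have "(N ?k)\<^sup>2 \<le> cmod (semi_inner UNIV norm (?k x) \<xi>)"
    unfolding rep by (rule norm_square_le_semi_inner_self[OF U(1) k])
  also have "\<dots> \<le> norm (K x x \<xi>) * norm \<xi>"
    \<comment> \<open>Since \<open>x \<in> X\<close>, the section takes the value
      \<open>K x x \<xi>\<close> at \<open>x\<close>.\<close>
    using semi_inner_bound[OF U(2), of "?k x" \<xi>] assms(3) by (simp add: kernel_section_def)
  also have "\<dots> \<le> bounded_maps_norm (K x x) * norm \<xi> * norm \<xi>"
    by (intro mult_right_mono bounded_maps_normD K) simp
  finally have "N ?k \<le> sqrt (bounded_maps_norm (K x x) * (norm \<xi>)\<^sup>2)"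
    by (intro real_le_rsqrt) (simp add: power2_eq_square mult.assoc)
  then show ?thesis by (simp add: real_sqrt_mult)
qed

lemma RKBS_evaluation_bound:
  assumes "RKBS X B N" "reproducing_kernel X B N K" "x \<in> X" "g \<in> B"
  shows "norm (g x) \<le> N g * sqrt (bounded_maps_norm (K x x))"
proof (cases "g x = 0")
  case True
  have "K x x \<in> bounded_maps"
    using assms(2,3) by (auto simp: reproducing_kernel_def)
  moreover have "0 \<le> N g"
    using assms(1,4) by (simp add: RKBS_def uniform_banach_def complex_banach_on_def)
  ultimately show ?thesis
    using True by (simp add: bounded_maps_norm_nonneg)
next
  case False
  let ?k = "kernel_section X K x (g x)" and ?c = "sqrt (bounded_maps_norm (K x x))"
  have U: "uniform_banach B N" "uniform_banach (UNIV :: 'b set) norm"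
    using assms(1) by (auto simp: RKBS_def)
  then have g: "0 \<le> N g"
    using assms(4) by (simp add: uniform_banach_def complex_banach_on_def)
  have k: "?k \<in> B"
    and rep: "semi_inner UNIV norm (g x) (g x) = semi_inner B N g ?k"
    using assms(2-4) unfolding reproducing_kernel_def by blast+
  have "(norm (g x))\<^sup>2 \<le> cmod (semi_inner B N g ?k)"
    unfolding rep[symmetric] by (rule norm_square_le_semi_inner_self[OF U(2) UNIV_I])
  also have "\<dots> \<le> N g * N ?k"
    by (rule semi_inner_bound[OF U(1) assms(4) k])
  also have "\<dots> \<le> N g * (?c * norm (g x))"
    by (intro mult_left_mono kernel_section_norm_le[OF assms(1-3)] g)
  \<comment> \<open>One factor \<open>norm (g x)\<close> cancels, which is why
    \<open>g x = 0\<close> was treated apart.\<close>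
  finally show ?thesis
    using False by (simp add: power2_eq_square mult.assoc[symmetric])
qed

theorem proposition2p5:
  fixes X :: "'x set"
    and B :: "('x \<Rightarrow> 'l::complex_banach) set"
    and N :: "('x \<Rightarrow> 'l) \<Rightarrow> real"
    and K :: "'x \<Rightarrow> 'x \<Rightarrow> 'l \<Rightarrow> 'l"
    and f :: "nat \<Rightarrow> 'x \<Rightarrow> 'l"
    and f0 :: "'x \<Rightarrow> 'l"
  assumes "uniform_banach (UNIV :: 'l set) norm"
    and "RKBS X B N"
    and "reproducing_kernel X B N K"
    and "\<And>n. f n \<in> B"
    and "f0 \<in> B"
    and "limitin (norm_topology B N) f f0 sequentially"
  shows "(\<forall>x\<in>X. (\<lambda>n. f n x) \<longlonglongrightarrow> f0 x) \<and>
    (\<forall>S\<subseteq>X. bdd_above ((\<lambda>x. bounded_maps_norm (K x x)) ` S) \<longrightarrow>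
       uniform_limit S f f0 sequentially)"
proof -
  have ban: "complex_banach_on B N"
    using assms(2) by (simp add: RKBS_def uniform_banach_def)
  interpret M: Metric_space B "norm_dist B N"
    by (rule Metric_space_norm_dist[OF ban])
  have diff: "f n - f0 \<in> B" for n
    using ban assms(4,5) by (auto simp: complex_banach_on_def intro: complex_vector.subspace_diff)
  then have N: "0 \<le> N (f n - f0)" for n
    using ban by (simp add: complex_banach_on_def)
  \<comment> \<open>All functions involved lie in \<open>B\<close>, where \<open>norm_dist\<close>
    is the norm of the difference.\<close>
  have "\<forall>e>0. \<forall>\<^sub>F n in sequentially. N (f n - f0) < e"
    using assms(4-6) by (auto simp: norm_topology_def M.limitin_metric norm_dist_def)
  then have lim: "(\<lambda>n. N (f n - f0)) \<longlonglongrightarrow> 0"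
    by (simp add: tendsto_iff N)
  have unif: "uniform_limit S f f0 sequentially"
    if S: "S \<subseteq> X" and bdd: "bdd_above ((\<lambda>x. bounded_maps_norm (K x x)) ` S)" for S
  proof -
    \<comment> \<open>The sign of \<open>C\<close> is irrelevant: \<open>sqrt\<close> is monotone on
      all reals, and \<open>N (f n - f0) * sqrt C\<close> tends to 0 for every
      \<open>C\<close>.\<close>
    obtain C where C: "bounded_maps_norm (K x x) \<le> C" if "x \<in> S" for x
      using bdd by (auto simp: bdd_above_def)
    have bound: "dist (f n x) (f0 x) \<le> N (f n - f0) * sqrt C" if "x \<in> S" for n x
    proof -
      have "norm ((f n - f0) x) \<le> N (f n - f0) * sqrt (bounded_maps_norm (K x x))"
        using RKBS_evaluation_bound[OF assms(2,3) _ diff] S that by blast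
      also have "\<dots> \<le> N (f n - f0) * sqrt C"
        using C[OF that] N by (intro mult_left_mono) auto
      finally show ?thesis by (simp add: dist_norm)
    qed
    have "(\<lambda>n. N (f n - f0) * sqrt C) \<longlonglongrightarrow> 0"
      using tendsto_mult_right[OF lim, of "sqrt C"] by simp
    then have ev: "\<forall>\<^sub>F n in sequentially. N (f n - f0) * sqrt C < e" if "e > 0" for e
      using that by (rule order_tendstoD(2))
    show ?thesis
      unfolding uniform_limit_iff
    proof (intro allI impI)
      fix e :: real
      assume "e > 0"
      from ev[OF this] show "\<forall>\<^sub>F n in sequentially. \<forall>x\<in>S. dist (f n x) (f0 x) < e"
      proof eventually_elim
        case (elim n)
        show ?case
          by (intro ballI le_less_trans[OF bound elim])
      qed
    qed
  qed
  have "(\<lambda>n. f n x) \<longlonglongrightarrow> f0 x" if "x \<in> X" for x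
  proof -
    \<comment> \<open>Pointwise convergence is uniform convergence on a singleton, where the kernel
      norm is trivially bounded.\<close>
    have "uniform_limit {x} f f0 sequentially"
      using that by (intro unif) simp_all
    then show ?thesis
      by (rule tendsto_uniform_limitI) simp
  qed
  with unif show ?thesis by (intro conjI ballI allI impI)
qed

end
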